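(* Consider the $l$-th MGU layer, $l\in\{1,\dots,L\}$, with parameters $W_f^{(l)},W_{\tilde h}^{(l)}\in\mathbb R^{n_h^{(l)}\times n_{\tilde u}^{(l)}}$, $R_f^{(l)},R_{\tilde h}^{(l)}\in\mathbb R^{n_h^{(l)}\times n_h^{(l)}}$, $\boldsymbol b_f^{(l)},\boldsymbol b_{\tilde h}^{(l)}\in\mathbb R^{n_h^{(l)}}$, and let $$\bar\sigma_f^{(l)}:=\sigma\left(\left\|\begin{bmatrix}W_f^{(l)} & R_f^{(l)} & \boldsymbol b_f^{(l)}\end{bmatrix}\right\|\right),\qquad \bar\phi_{\tilde h}^{(l)}:=\phi\left(\left\|\begin{bmatrix}W_{\tilde h}^{(l)} & R_{\tilde h}^{(l)} & \boldsymbol b_{\tilde h}^{(l)}\end{bmatrix}\right\|\right).$$ If the layer satisfies the sufficient $\delta$ISS condition $$\bar\sigma_f^{(l)}+\big(\bar\sigma_f^{(l)}\big)^2\|R_{\tilde h}^{(l)}\|+\tfrac14\|R_f^{(l)}\|\left(\bar\sigma_f^{(l)}\|R_{\tilde h}^{(l)}\|+\bar\phi_{\tilde h}^{(l)}+1\right)<1,$$ then it also satisfies the ISS condition $$\bar\sigma_f^{(l)}\|R_{\tilde h}^{(l)}\|<1.$$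
   Context: $\|\cdot\|$ is the infinity norm of vectors and the induced infinity norm of matrices (maximum absolute row sum); $\sigma(x)=1/(1+e^{-x})$; $\phi(x)=\tanh(x)$; $[A\ B\ C]$ denotes horizontal concatenation. These are the weights and biases of the MGU (Minimal Gated Unit) layer, whose dynamics are $\boldsymbol f_k^{(l)}=\boldsymbol\sigma(W_f^{(l)}\tilde{\boldsymbol u}_k^{(l)}+R_f^{(l)}\boldsymbol h_k^{(l)}+\boldsymbol b_f^{(l)})$, $\tilde{\boldsymbol h}_k^{(l)}=\boldsymbol\phi(W_{\tilde h}^{(l)}\tilde{\boldsymbol u}_k^{(l)}+R_{\tilde h}^{(l)}(\boldsymbol f_k^{(l)}\circ\boldsymbol h_k^{(l)})+\boldsymbol b_{\tilde h}^{(l)})$, $\boldsymbol h_{k+1}^{(l)}=(\boldsymbol 1-\boldsymbol f_k^{(l)})\circ\boldsymbol h_k^{(l)}+\boldsymbol f_k^{(l)}\circ\tilde{\boldsymbol h}_k^{(l)}$ (bold functions act component-wise, $\circ$ is the element-wise product, $\boldsymbol 1$ is the all-ones vector). Both conditions involve only the parameters. *)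

theory Defs
  imports Complex_Main "Jordan_Normal_Form.Matrix"
begin

(* Vectors and matrices carry their dimensions as values, because the dimensions of a layer
   depend on the layer index. The inserted 0 only matters for empty index ranges. *)

definition vec_inf_norm :: "real vec \<Rightarrow> real" where
  "vec_inf_norm v = Max (insert 0 ((\<lambda>i. \<bar>v $ i\<bar>) ` {..<dim_vec v}))"

definition mat_inf_norm :: "real mat \<Rightarrow> real" where
  "mat_inf_norm A =
     Max (insert 0 ((\<lambda>i. \<Sum>j<dim_col A. \<bar>A $$ (i, j)\<bar>) ` {..<dim_row A}))"

lemma vec_inf_norm_nonneg: "0 \<le> vec_inf_norm v"
  unfolding vec_inf_norm_def by (intro Max_ge) auto

lemma abs_le_vec_inf_norm: "i < dim_vec v \<Longrightarrow> \<bar>v $ i\<bar> \<le> vec_inf_norm v"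
  unfolding vec_inf_norm_def by (intro Max_ge) auto

lemma vec_inf_norm_le:
  assumes "0 \<le> c" "\<And>i. i < dim_vec v \<Longrightarrow> \<bar>v $ i\<bar> \<le> c"
  shows "vec_inf_norm v \<le> c"
  unfolding vec_inf_norm_def using assms by (subst Max_le_iff) auto

lemma mat_inf_norm_nonneg: "0 \<le> mat_inf_norm A"
  unfolding mat_inf_norm_def by (intro Max_ge) auto

lemma row_sum_le_mat_inf_norm:
  "i < dim_row A \<Longrightarrow> (\<Sum>j<dim_col A. \<bar>A $$ (i, j)\<bar>) \<le> mat_inf_norm A"
  unfolding mat_inf_norm_def by (intro Max_ge) auto

lemma vec_inf_norm_mult_mat_vec_le:
  assumes "v \<in> carrier_vec (dim_col A)"
  shows "vec_inf_norm (A *\<^sub>v v) \<le> mat_inf_norm A * vec_inf_norm v"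
proof (rule vec_inf_norm_le)
  show "0 \<le> mat_inf_norm A * vec_inf_norm v"
    by (simp add: mat_inf_norm_nonneg vec_inf_norm_nonneg)
next
  fix i assume "i < dim_vec (A *\<^sub>v v)"
  then have i: "i < dim_row A" by simp
  have v: "dim_vec v = dim_col A" using assms by simp
  have "\<bar>(A *\<^sub>v v) $ i\<bar> = \<bar>\<Sum>j<dim_col A. A $$ (i, j) * v $ j\<bar>"
    using i v by (simp add: scalar_prod_def atLeast0LessThan)
  also have "\<dots> \<le> (\<Sum>j<dim_col A. \<bar>A $$ (i, j)\<bar> * \<bar>v $ j\<bar>)"
    by (rule order_trans[OF sum_abs]) (simp add: abs_mult)
  also have "\<dots> \<le> (\<Sum>j<dim_col A. \<bar>A $$ (i, j)\<bar> * vec_inf_norm v)"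
    by (intro sum_mono mult_left_mono abs_le_vec_inf_norm) (auto simp: v)
  also have "\<dots> = (\<Sum>j<dim_col A. \<bar>A $$ (i, j)\<bar>) * vec_inf_norm v"
    by (simp add: sum_distrib_right)
  also have "\<dots> \<le> mat_inf_norm A * vec_inf_norm v"
    by (intro mult_right_mono row_sum_le_mat_inf_norm i vec_inf_norm_nonneg)
  finally show "\<bar>(A *\<^sub>v v) $ i\<bar> \<le> mat_inf_norm A * vec_inf_norm v" .
qed

lemma mat_inf_norm_attained:
  "\<exists>v \<in> carrier_vec (dim_col A). vec_inf_norm v \<le> 1 \<and> vec_inf_norm (A *\<^sub>v v) = mat_inf_norm A"
proof -
  have "mat_inf_norm A \<in> insert 0 ((\<lambda>i. \<Sum>j<dim_col A. \<bar>A $$ (i, j)\<bar>) ` {..<dim_row A})"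
    unfolding mat_inf_norm_def by (intro Max_in) auto
  then consider "mat_inf_norm A = 0"
    | i where "i < dim_row A" "mat_inf_norm A = (\<Sum>j<dim_col A. \<bar>A $$ (i, j)\<bar>)"
    by auto
  then show ?thesis
  proof cases
    case 1
    have "vec_inf_norm (0\<^sub>v (dim_col A)) \<le> 1" by (intro vec_inf_norm_le) auto
    moreover have "vec_inf_norm (A *\<^sub>v 0\<^sub>v (dim_col A)) = mat_inf_norm A"
      using vec_inf_norm_mult_mat_vec_le[of "0\<^sub>v (dim_col A)" A]
        vec_inf_norm_nonneg[of "A *\<^sub>v 0\<^sub>v (dim_col A)"] 1 by simp
    ultimately show ?thesis by (intro bexI[of _ "0\<^sub>v (dim_col A)"]) auto
  next
    case (2 i)
    define v where "v = vec (dim_col A) (\<lambda>j. sgn (A $$ (i, j)))"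
    have v: "v \<in> carrier_vec (dim_col A)" by (simp add: v_def)
    have v1: "vec_inf_norm v \<le> 1"
      by (intro vec_inf_norm_le) (auto simp: v_def sgn_if)
    have "(A *\<^sub>v v) $ i = (\<Sum>j<dim_col A. A $$ (i, j) * sgn (A $$ (i, j)))"
      using 2(1) by (simp add: v_def scalar_prod_def atLeast0LessThan)
    also have "\<dots> = mat_inf_norm A" unfolding 2(2) by (simp add: abs_sgn)
    finally have "mat_inf_norm A \<le> vec_inf_norm (A *\<^sub>v v)"
      using abs_le_vec_inf_norm[of i "A *\<^sub>v v"] 2(1) by simp
    moreover have "vec_inf_norm (A *\<^sub>v v) \<le> mat_inf_norm A"
      using vec_inf_norm_mult_mat_vec_le[OF v] mult_left_mono[OF v1 mat_inf_norm_nonneg, of A]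
      by simp
    ultimately show ?thesis using v v1 by (intro bexI[of _ v]) auto
  qed
qed

theorem mat_inf_norm_induced:
  "mat_inf_norm A =
     Sup {vec_inf_norm (A *\<^sub>v v) | v. v \<in> carrier_vec (dim_col A) \<and> vec_inf_norm v \<le> 1}"
proof (rule sym, rule cSup_eq_maximum)
  show "mat_inf_norm A \<in>
      {vec_inf_norm (A *\<^sub>v v) | v. v \<in> carrier_vec (dim_col A) \<and> vec_inf_norm v \<le> 1}"
    using mat_inf_norm_attained[of A] by force
next
  fix x
  assume "x \<in> {vec_inf_norm (A *\<^sub>v v) | v. v \<in> carrier_vec (dim_col A) \<and> vec_inf_norm v \<le> 1}"
  then obtain v where v: "v \<in> carrier_vec (dim_col A)" "vec_inf_norm v \<le> 1"
    and x: "x = vec_inf_norm (A *\<^sub>v v)" by auto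
  show "x \<le> mat_inf_norm A"
    unfolding x using vec_inf_norm_mult_mat_vec_le[OF v(1)]
      mult_left_mono[OF v(2) mat_inf_norm_nonneg, of A] by simp
qed

definition sigmoid :: "real \<Rightarrow> real" where
  "sigmoid x = 1 / (1 + exp (- x))"

definition hconcat :: "real mat \<Rightarrow> real mat \<Rightarrow> real vec \<Rightarrow> real mat" where
  "hconcat W R b = mat_of_cols (dim_row W) (cols W @ cols R @ [b])"

lemma hconcat_carrier:
  assumes "W \<in> carrier_mat n m" "R \<in> carrier_mat n k"
  shows "hconcat W R b \<in> carrier_mat n (m + k + 1)"
  using assms by (auto simp: hconcat_def)

lemma hconcat_index:
  assumes "W \<in> carrier_mat n m" "R \<in> carrier_mat n k" "b \<in> carrier_vec n"
    and "i < n" "j < m + k + 1"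
  shows "hconcat W R b $$ (i, j) =
    (if j < m then W $$ (i, j) else if j < m + k then R $$ (i, j - m) else b $ i)"
  using assms by (auto simp: hconcat_def mat_of_cols_index nth_append)

definition sigma_bar :: "real mat \<Rightarrow> real mat \<Rightarrow> real vec \<Rightarrow> real" where
  "sigma_bar W R b = sigmoid (mat_inf_norm (hconcat W R b))"

definition phi_bar :: "real mat \<Rightarrow> real mat \<Rightarrow> real vec \<Rightarrow> real" where
  "phi_bar W R b = tanh (mat_inf_norm (hconcat W R b))"

end

theory Submission
  imports Defs
begin

text \<open>The matrix norm is nonnegative, so the bound on the forget gate satisfies
  \<open>\<sigma> \<ge> \<sigma>(0) = 1/2\<close>. The summand with factor \<open>1/4\<close> in the \<open>\<delta>\<close>ISS condition is nonnegative and can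
  be dropped, which leaves \<open>\<sigma> (1 + \<sigma> r) < 1\<close> with \<open>r\<close> the norm of the recurrent matrix of the
  candidate state. If \<open>\<sigma> r \<ge> 1\<close> held, the left-hand side would be at least \<open>2 \<sigma> \<ge> 1\<close>.\<close>

lemma sigmoid_ge_half: "0 \<le> x \<Longrightarrow> 1 / 2 \<le> sigmoid x"
  by (simp add: sigmoid_def field_simps add_pos_pos)

lemma sigma_bar_ge_half: "1 / 2 \<le> sigma_bar W R b"
  unfolding sigma_bar_def by (intro sigmoid_ge_half mat_inf_norm_nonneg)

lemma phi_bar_nonneg: "0 \<le> phi_bar W R b"
  unfolding phi_bar_def by (simp add: mat_inf_norm_nonneg)

lemma mult_less_1_if_add_sq_mult_less_1:
  fixes s r :: real
  assumes "1 / 2 \<le> s" and "s + s\<^sup>2 * r < 1"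
  shows "s * r < 1"
proof (rule ccontr)
  assume "\<not> s * r < 1"
  then have "s * 1 \<le> s * (s * r)"
    using assms(1) by (intro mult_left_mono) auto
  then show False
    using assms unfolding power2_eq_square mult.assoc by linarith
qed

theorem proposition2:
  fixes L l :: nat
    and n_h n_u :: "nat \<Rightarrow> nat"
    and W_f W_h R_f R_h :: "nat \<Rightarrow> real mat"
    and b_f b_h :: "nat \<Rightarrow> real vec"
  assumes "l \<in> {1..L}"
    and "W_f l \<in> carrier_mat (n_h l) (n_u l)" "W_h l \<in> carrier_mat (n_h l) (n_u l)"
    and "R_f l \<in> carrier_mat (n_h l) (n_h l)" "R_h l \<in> carrier_mat (n_h l) (n_h l)"
    and "b_f l \<in> carrier_vec (n_h l)" "b_h l \<in> carrier_vec (n_h l)"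
    and "sigma_bar (W_f l) (R_f l) (b_f l)
         + (sigma_bar (W_f l) (R_f l) (b_f l))\<^sup>2 * mat_inf_norm (R_h l)
         + 1 / 4 * mat_inf_norm (R_f l)
             * (sigma_bar (W_f l) (R_f l) (b_f l) * mat_inf_norm (R_h l)
                + phi_bar (W_h l) (R_h l) (b_h l) + 1) < 1"
  shows "sigma_bar (W_f l) (R_f l) (b_f l) * mat_inf_norm (R_h l) < 1"
proof -
  have "0 \<le> 1 / 4 * mat_inf_norm (R_f l)
             * (sigma_bar (W_f l) (R_f l) (b_f l) * mat_inf_norm (R_h l)
                + phi_bar (W_h l) (R_h l) (b_h l) + 1)"
    using sigma_bar_ge_half[of "W_f l" "R_f l" "b_f l"]
    by (intro mult_nonneg_nonneg add_nonneg_nonneg mat_inf_norm_nonneg phi_bar_nonneg) auto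
  with assms(8) show ?thesis
    by (intro mult_less_1_if_add_sq_mult_less_1 sigma_bar_ge_half) linarith
qed

end
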